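(* Let $x=\{x_1,x_2,\ldots\}$ be a sequence of real numbers. The following inverse relations hold for all $n,k\in\mathbb{N}$ (positive integers). (i) (Ordinary type.) If $y_n=\hat{B}_{n,k}(x)$, then $$x_n=\sum_{j=0}^{n-1}\binom{1/k}{j}\,x_1^{1-kj}\,\hat{B}_{n-1,j}(w),\qquad\text{where } w_n=y_{n+k}.$$ (ii) (Exponential type.) If $y_n=B_{n,k}(x)$, then $$x_n=\sum_{j=0}^{n-1}(1/k)_j\,x_1^{1-kj}\,n\,B_{n-1,j}(w),\qquad\text{where } w_n=y_{n+k}\Big/\binom{n+k}{k}.$$
   Context: For a real sequence $x=\{x_1,x_2,\ldots\}$ the partial exponential Bell polynomials are $$B_{n,k}(x)=\sum \frac{n!}{j_1!\,j_2!\cdots j_n!}\left(\frac{x_1}{1!}\right)^{j_1}\left(\frac{x_2}{2!}\right)^{j_2}\cdots\left(\frac{x_n}{n!}\right)^{j_n},$$ the sum being over all $n$-tuples of nonnegative integers $(j_1,\ldots,j_n)$ with $j_1+j_2+\cdots+j_n=k$ and $j_1+2j_2+\cdots+nj_n=n$. Conventions: $B_{0,0}(x)=1$, and $B_{n,0}(x)=B_{0,k}(x)=0$ for $n,k\ge 1$; $B_{n,k}(x)=0$ for $n<k$. The partial ordinary Bell polynomials are $\hat{B}_{n,k}(x)=\frac{k!}{n!}B_{n,k}(\tilde x)$, where $\tilde x_m=m!\,x_m$. Equivalently, $\left(\sum_{j\ge 1}x_jz^j\right)^k=\sum_{n\ge k}\hat{B}_{n,k}(x)z^n$. When $w$ is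 the argument of a Bell polynomial, it stands for the sequence $\{w_1,w_2,\ldots\}$. For real $\alpha$ and integer $j\ge 0$, $(\alpha)_j=\alpha(\alpha-1)\cdots(\alpha-j+1)$ (with $(\alpha)_0=1$) and $\binom{\alpha}{j}=(\alpha)_j/j!$.
   Formalization: The formal theorem assumes x_1 ≠ 0 unless k = 1 or n = 1; for x_1 = 0 with k, n ≥ 2 the term j = 1 contains the undefined negative power 0^{1-k}, so the formula has no meaning there. *)

theory Defs
  imports Complex_Main "HOL-Library.FuncSet"
begin

text \<open>Sequences $x_1, x_2, \ldots$ are functions on \<^typ>\<open>nat\<close> whose value at 0 is never used.\<close>

text \<open>
  The tuples $(j_1,\ldots,j_n)$ are extensional functions on $\{1,\ldots,n\}$. For $n = 0$ there is
  exactly one, the empty tuple.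
\<close>

definition bell_tuples :: "nat \<Rightarrow> nat \<Rightarrow> (nat \<Rightarrow> nat) set" where
  "bell_tuples n k =
     {j \<in> {1..n} \<rightarrow>\<^sub>E UNIV. (\<Sum>i = 1..n. j i) = k \<and> (\<Sum>i = 1..n. i * j i) = n}"

lemma finite_bell_tuples: "finite (bell_tuples n k)"
proof (rule finite_subset)
  show "bell_tuples n k \<subseteq> {1..n} \<rightarrow>\<^sub>E {..k}"
  proof
    fix j assume j: "j \<in> bell_tuples n k"
    have "j i \<le> k" if "i \<in> {1..n}" for i
      using member_le_sum[of i "{1..n}" j] that j by (auto simp: bell_tuples_def)
    with j show "j \<in> {1..n} \<rightarrow>\<^sub>E {..k}"
      by (auto simp: bell_tuples_def PiE_iff)
  qed
  show "finite ({1..n} \<rightarrow>\<^sub>E {..k})"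
    by (intro finite_PiE) auto
qed

definition bell_partial :: "nat \<Rightarrow> nat \<Rightarrow> (nat \<Rightarrow> real) \<Rightarrow> real" where
  "bell_partial n k x =
     (\<Sum>j \<in> bell_tuples n k.
        fact n / (\<Prod>i = 1..n. fact (j i)) * (\<Prod>i = 1..n. (x i / fact i) ^ j i))"

lemma bell_partial_0_0: "bell_partial 0 0 x = 1"
  by (simp add: bell_partial_def bell_tuples_def)

lemma bell_partial_0_right:
  assumes "n \<ge> 1"
  shows "bell_partial n 0 x = 0"
proof -
  have "(\<Sum>i = 1..n. i * j i) = 0" if "(\<Sum>i = 1..n. j i) = 0" for j :: "nat \<Rightarrow> nat"
    using that by simp
  with assms have "bell_tuples n 0 = {}"
    unfolding bell_tuples_def by fastforce
  then show ?thesis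
    by (simp add: bell_partial_def)
qed

lemma bell_partial_less:
  assumes "n < k"
  shows "bell_partial n k x = 0"
proof -
  have "j \<notin> bell_tuples n k" for j
  proof
    assume "j \<in> bell_tuples n k"
    moreover have "(\<Sum>i = 1..n. j i) \<le> (\<Sum>i = 1..n. i * j i)"
      by (rule sum_mono) auto
    ultimately show False
      using assms by (simp add: bell_tuples_def)
  qed
  then have "bell_tuples n k = {}"
    by blast
  then show ?thesis
    by (simp add: bell_partial_def)
qed

definition bell_ordinary :: "nat \<Rightarrow> nat \<Rightarrow> (nat \<Rightarrow> real) \<Rightarrow> real" where
  "bell_ordinary n k x = fact k / fact n * bell_partial n k (\<lambda>m. fact m * x m)"

definition falling_factorial :: "real \<Rightarrow> nat \<Rightarrow> real" where
  "falling_factorial a j = (\<Prod>i<j. a - real i)"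

lemma gbinomial_eq_falling_factorial: "a gchoose j = falling_factorial a j / fact j"
  by (simp add: falling_factorial_def gbinomial_prod_rev atLeast0LessThan)

end

theory Submission
  imports Defs "HOL-Computational_Algebra.Formal_Power_Series"
begin

unbundle fps_syntax

text \<open>
  Write $X(z) = \sum_{j \ge 1} x_j z^j = z\,G(z)$. By the multinomial theorem,
  $\hat B_{n,k}(x)$ is the coefficient of $z^n$ in $X^k$, so that
  $G^k = x_1^k + W$ with $W = \sum_{m \ge 1} y_{m+k} z^m$. A power series is determined by its
  $k$-th power and its nonzero constant coefficient, hence
  $G = x_1 (1 + W / x_1^k)^{1/k}$, and the binomial series gives (i).
  Part (ii) is (i) for the sequence $x_m / m!$.
\<close>

section \<open>The multinomial theorem over a commutative semiring\<close>

text \<open>Iterating a! b! | (a+b)! over the index set. This makes the \<open>div\<close> in the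
  multinomial coefficients exact.\<close>

lemma prod_fact_dvd_fact_sum:
  "(\<Prod>i\<in>A. fact (j i)) dvd (fact (\<Sum>i\<in>A. j i) :: nat)"
proof (induction A rule: infinite_finite_induct)
  case (insert a A)
  have "fact (j a) * (\<Prod>i\<in>A. fact (j i)) dvd (fact (j a) * fact (\<Sum>i\<in>A. j i) :: nat)"
    using insert.IH by (rule mult_dvd_mono[OF dvd_refl])
  also have "\<dots> dvd fact (j a + (\<Sum>i\<in>A. j i))"
    by (rule fact_fact_dvd_fact)
  finally show ?case
    using insert.hyps by simp
qed auto

lemma finite_PiE_sum_eq:
  assumes "finite A"
  shows "finite {j. j \<in> A \<rightarrow>\<^sub>E (UNIV :: nat set) \<and> sum j A = k}"
proof (rule finite_subset)
  show "{j. j \<in> A \<rightarrow>\<^sub>E (UNIV :: nat set) \<and> sum j A = k} \<subseteq> A \<rightarrow>\<^sub>E {..k}"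
    using assms by (auto simp: PiE_iff extensional_def intro: member_le_sum)
  show "finite (A \<rightarrow>\<^sub>E {..k})"
    using assms by (intro finite_PiE) auto
qed

theorem multinomial:
  fixes f :: "'a \<Rightarrow> 'b::comm_semiring_1"
  assumes "finite A"
  shows "(\<Sum>i\<in>A. f i) ^ k =
    (\<Sum>j | j \<in> A \<rightarrow>\<^sub>E UNIV \<and> sum j A = k.
       of_nat (fact k div (\<Prod>i\<in>A. fact (j i))) * (\<Prod>i\<in>A. f i ^ j i))"
  using assms
proof (induction A arbitrary: k rule: finite_induct)
  case empty
  have "{j. j \<in> {} \<rightarrow>\<^sub>E (UNIV :: nat set) \<and> sum j {} = k} =
      (if k = 0 then {\<lambda>_::'a. undefined} else {})"
    by auto
  then show ?case
    by (simp only:) (simp add: power_0_left)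
next
  case (insert a A)
  let ?S = "\<lambda>k. {j. j \<in> A \<rightarrow>\<^sub>E (UNIV :: nat set) \<and> sum j A = k}"
  let ?T = "{j. j \<in> insert a A \<rightarrow>\<^sub>E (UNIV :: nat set) \<and> sum j (insert a A) = k}"
  let ?t = "\<lambda>A k j. of_nat (fact k div (\<Prod>i\<in>A. fact (j i))) * (\<Prod>i\<in>A. f i ^ j i)"
  have upd_sum: "sum (g(a := m)) A = sum g A" for g :: "'a \<Rightarrow> nat" and m
    using insert.hyps(2) by (intro sum.cong) auto
  have term_eq: "of_nat (k choose m) * f a ^ m * ?t A (k - m) g = ?t (insert a A) k (g(a := m))"
    if m: "m \<le> k" and g: "g \<in> ?S (k - m)" for m g
  proof -
    let ?P = "\<Prod>i\<in>A. fact (g i) :: nat"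
    have dvd: "?P dvd fact (k - m)"
      using prod_fact_dvd_fact_sum[of g A] g by simp
    \<comment> \<open>Both divisions are exact, so k! = m! (k-m)! C(k,m) can be regrouped with
      \<open>?P\<close> as a factor.\<close>
    have "fact k = fact m * ?P * ((k choose m) * (fact (k - m) div ?P))"
      using binomial_fact_lemma[OF m] dvd
      by (metis (no_types, lifting) dvd_mult_div_cancel mult.assoc mult.left_commute mult.commute)
    then have coeff: "(k choose m) * (fact (k - m) div ?P) = fact k div (fact m * ?P)"
      by simp
    have P: "(\<Prod>i\<in>A. fact ((g(a := m)) i)) = ?P"
      and Q: "(\<Prod>i\<in>A. f i ^ (g(a := m)) i) = (\<Prod>i\<in>A. f i ^ g i)"
      using insert.hyps(2) by (auto intro!: prod.cong)
    have "?t (insert a A) k (g(a := m)) =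
        of_nat (fact k div (fact m * ?P)) * (f a ^ m * (\<Prod>i\<in>A. f i ^ g i))"
      using insert.hyps by (simp add: P Q del: fun_upd_apply) simp
    then show ?thesis
      unfolding coeff[symmetric] by (simp add: mult_ac)
  qed
  have "(\<Sum>i\<in>insert a A. f i) ^ k =
      (\<Sum>m\<le>k. of_nat (k choose m) * f a ^ m * (\<Sum>i\<in>A. f i) ^ (k - m))"
    using insert.hyps by (simp add: binomial_ring)
  also have "\<dots> = (\<Sum>m\<le>k. \<Sum>g\<in>?S (k - m). of_nat (k choose m) * f a ^ m * ?t A (k - m) g)"
    by (simp add: insert.IH sum_distrib_left)
  also have "\<dots> = (\<Sum>m\<le>k. \<Sum>g\<in>?S (k - m). ?t (insert a A) k (g(a := m)))"
    by (intro sum.cong refl term_eq) auto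
  also have "\<dots> = (\<Sum>(m, g)\<in>Sigma {..k} (\<lambda>m. ?S (k - m)). ?t (insert a A) k (g(a := m)))"
    using insert.hyps(1) finite_PiE_sum_eq by (subst sum.Sigma) auto
  also have "\<dots> = (\<Sum>j\<in>?T. ?t (insert a A) k j)"
  \<comment> \<open>A tuple on \<open>insert a A\<close> is its value \<open>m\<close> at
    \<open>a\<close> together with its restriction to \<open>A\<close>; resetting \<open>a\<close>
    to \<open>undefined\<close> makes that restriction extensional.\<close>
  proof (rule sum.reindex_bij_witness[where i = "\<lambda>j. (j a, j(a := undefined))"
        and j = "\<lambda>(m, g). g(a := m)"])
    fix p assume p: "p \<in> Sigma {..k} (\<lambda>m. ?S (k - m))"
    obtain m g where [simp]: "p = (m, g)"
      by (cases p)
    from p have mg: "m \<le> k" "g \<in> A \<rightarrow>\<^sub>E UNIV" "sum g A = k - m"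
      by auto
    have "g a = undefined"
      using mg(2) insert.hyps(2) by (rule PiE_arb)
    then show "((case p of (m, g) \<Rightarrow> g(a := m)) a, (case p of (m, g) \<Rightarrow> g(a := m))(a := undefined)) = p"
      by auto
    show "(case p of (m, g) \<Rightarrow> g(a := m)) \<in> ?T"
      using mg insert.hyps by (auto simp: upd_sum PiE_fun_upd fun_upd_same simp del: fun_upd_apply)
  next
    fix j assume j: "j \<in> ?T"
    then show "(case (j a, j(a := undefined)) of (m, g) \<Rightarrow> g(a := m)) = j"
      by simp
    show "(j a, j(a := undefined)) \<in> Sigma {..k} (\<lambda>m. ?S (k - m))"
      using j insert.hyps by (auto simp: upd_sum fun_upd_in_PiE simp del: fun_upd_apply)
  qed auto
  finally show ?case .
qed

section \<open>Ordinary Bell polynomials as coefficients of powers\<close>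

text \<open>Allows an infinite series to be truncated at degree \<open>n\<close>, so that the finite
  multinomial theorem applies to it.\<close>

lemma fps_power_nth_cong:
  fixes F G :: "'a::comm_semiring_1 fps"
  assumes "\<And>i. i \<le> n \<Longrightarrow> F $ i = G $ i"
  shows "(F ^ k) $ n = (G ^ k) $ n"
proof -
  have "(F ^ k) $ m = (G ^ k) $ m" if "m \<le> n" for m
    using that
  proof (induction k arbitrary: m)
    case (Suc k)
    then show ?case
      using assms by (auto simp: fps_mult_nth intro!: sum.cong)
  qed simp
  then show ?thesis
    by simp
qed

lemma fps_const_prod:
  fixes f :: "'a \<Rightarrow> 'b::comm_semiring_1"
  shows "fps_const (\<Prod>i\<in>A. f i) = (\<Prod>i\<in>A. fps_const (f i))"
  by (induction A rule: infinite_finite_induct) (simp_all flip: fps_const_mult)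

text \<open>The series X of the overview; its constant coefficient is forced to 0 because
  \<open>x 0\<close> is arbitrary.\<close>

definition seq_fps :: "(nat \<Rightarrow> real) \<Rightarrow> real fps" where
  "seq_fps x = Abs_fps (\<lambda>i. if i = 0 then 0 else x i)"

lemma seq_fps_nth [simp]: "seq_fps x $ i = (if i = 0 then 0 else x i)"
  by (simp add: seq_fps_def)

lemma bell_ordinary_eq_fps_nth: "bell_ordinary n k x = (seq_fps x ^ k) $ n"
proof -
  let ?S = "{j. j \<in> {1..n} \<rightarrow>\<^sub>E (UNIV :: nat set) \<and> sum j {1..n} = k}"
  let ?f = "\<lambda>i. fps_const (x i) * fps_X ^ i"
  let ?c = "\<lambda>j. real (fact k div (\<Prod>i = 1..n. fact (j i)))"
  have "(seq_fps x ^ k) $ n = ((\<Sum>i = 1..n. ?f i) ^ k) $ n"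
    by (rule fps_power_nth_cong) (auto simp: fps_sum_nth fps_X_power_iff mult_delta_right)
  also have "\<dots> = (\<Sum>j\<in>?S. (of_nat (fact k div (\<Prod>i = 1..n. fact (j i))) *
      (\<Prod>i = 1..n. ?f i ^ j i)) $ n)"
    by (subst multinomial) (simp_all add: fps_sum_nth)
  \<comment> \<open>Each product is a monomial of degree \<Sum> i j_i, so extracting coefficient
    \<open>n\<close> imposes the second condition of \<open>bell_tuples\<close>.\<close>
  also have "\<dots> = (\<Sum>j\<in>?S. if (\<Sum>i = 1..n. i * j i) = n
      then ?c j * (\<Prod>i = 1..n. x i ^ j i) else 0)"
  proof (intro sum.cong refl)
    fix j
    have "(\<Prod>i = 1..n. ?f i ^ j i) =
        fps_const (\<Prod>i = 1..n. x i ^ j i) * fps_X ^ (\<Sum>i = 1..n. i * j i)"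
      by (simp add: power_mult_distrib prod.distrib power_mult power_sum fps_const_prod)
    then show "(of_nat (fact k div (\<Prod>i = 1..n. fact (j i))) * (\<Prod>i = 1..n. ?f i ^ j i)) $ n =
        (if (\<Sum>i = 1..n. i * j i) = n then ?c j * (\<Prod>i = 1..n. x i ^ j i) else 0)"
      by (auto simp: fps_X_power_iff fps_of_nat[symmetric] simp del: fps_of_nat)
  qed
  also have "\<dots> = (\<Sum>j\<in>bell_tuples n k. ?c j * (\<Prod>i = 1..n. x i ^ j i))"
    using finite_PiE_sum_eq[of "{1..n}" k] by (simp add: sum.inter_filter[symmetric] bell_tuples_def conj_assoc)
  also have "\<dots> = (\<Sum>j\<in>bell_tuples n k. fact k / (\<Prod>i = 1..n. fact (j i)) * (\<Prod>i = 1..n. x i ^ j i))"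
  proof (intro sum.cong refl)
    fix j assume "j \<in> bell_tuples n k"
    then have "(\<Prod>i = 1..n. fact (j i)) dvd (fact k :: nat)"
      using prod_fact_dvd_fact_sum[of j "{1..n}"] by (simp add: bell_tuples_def)
    then show "?c j * (\<Prod>i = 1..n. x i ^ j i) =
        fact k / (\<Prod>i = 1..n. fact (j i)) * (\<Prod>i = 1..n. x i ^ j i)"
      by (simp add: real_of_nat_div)
  qed
  also have "\<dots> = bell_ordinary n k x"
    by (simp add: bell_ordinary_def bell_partial_def sum_distrib_left)
  finally show ?thesis ..
qed

section \<open>Inversion by k-th roots of power series\<close>

lemma fps_power_eq_imp_eq:
  fixes F G :: "'a::field_char_0 fps"
  assumes "F ^ k = G ^ k" "F $ 0 = G $ 0" "F $ 0 \<noteq> 0" "k > 0"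
  shows "F = G"
proof -
  obtain l where k: "k = Suc l"
    using assms(4) by (cases k) auto
  \<comment> \<open>The only scalar root required is that of the constant coefficient of
    \<open>G ^ k\<close>, namely \<open>F $ 0\<close>; a constant choice function suffices.\<close>
  let ?r = "\<lambda>_ _. F $ 0"
  have "F = fps_radical ?r (Suc l) (G ^ k)" "G = fps_radical ?r (Suc l) (G ^ k)"
    using radical_unique[of ?r l "G ^ k" F] radical_unique[of ?r l "G ^ k" G] assms k
    by (simp_all add: fps_power_zeroth del: power_Suc)
  then show ?thesis
    by simp
qed

lemma bell_ordinary_inverse_nonzero:
  fixes x :: "nat \<Rightarrow> real"
  assumes n: "n \<ge> 1" and k: "k \<ge> 1" and x1: "x 1 \<noteq> 0"
  shows "x n = (\<Sum>j = 0..n - 1. ((1 / real k) gchoose j) * x 1 powi (1 - int k * int j) *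
    bell_ordinary (n - 1) j (\<lambda>m. bell_ordinary (m + k) k x))"
proof -
  \<comment> \<open>The shift gives \<open>G\<close> the constant coefficient \<open>x 1\<close> and
    moves \<open>x n\<close> to index \<open>n - 1\<close>. \<open>V\<close> is \<open>W\<close>
    scaled so that \<open>x 1 ^ k\<close> can be factored out, and \<open>H\<close> is the candidate
    root.\<close>
  define G where "G = fps_shift 1 (seq_fps x)"
  define W where "W = seq_fps (\<lambda>m. bell_ordinary (m + k) k x)"
  define V where "V = fps_const (1 / x 1 ^ k) * W"
  define H where "H = fps_const (x 1) * (fps_binomial (1 / real k) oo V)"
  have G0: "G $ 0 = x 1"
    by (simp add: G_def)
  have F: "seq_fps x = G * fps_X"
    by (auto simp: fps_eq_iff G_def)
  \<comment> \<open>As X^k = G^k z^k, coefficient m of \<open>G ^ k\<close> is coefficient m + k of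
    X^k. \<open>W\<close> omits m = 0, which is supplied by the constant.\<close>
  have "G ^ k = fps_const (x 1 ^ k) + W"
    by (auto simp: fps_eq_iff W_def bell_ordinary_eq_fps_nth F power_mult_distrib
        fps_X_power_mult_right_nth fps_power_zeroth G0)
  also have "\<dots> = fps_const (x 1 ^ k) * (1 + V)"
    using x1 by (simp add: V_def distrib_left flip: mult.assoc)
  also have "\<dots> = H ^ k"
  proof -
    \<comment> \<open>A zero constant coefficient makes composition with \<open>V\<close> commute
      with powers.\<close>
    have "V $ 0 = 0"
      by (simp add: V_def W_def)
    then have "(fps_binomial (1 / real k) oo V) ^ k = 1 + V"
      using k by (simp add: fps_compose_power fps_binomial_power fps_binomial_1 fps_compose_add_distrib)
    then show ?thesis
      by (simp add: H_def power_mult_distrib)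
  qed
  finally have "G = H"
    using x1 k by (intro fps_power_eq_imp_eq[of G k H]) (auto simp: G0 H_def)
  have term_eq: "x 1 * (((1 / real k) gchoose j) * (V ^ j $ (n - 1))) =
      ((1 / real k) gchoose j) * x 1 powi (1 - int k * int j) * (W ^ j $ (n - 1))" for j
  proof -
    have "x 1 powi (1 - int k * int j) = x 1 / x 1 ^ (k * j)"
      using x1 by (simp add: power_int_diff flip: of_nat_mult)
    then show ?thesis
      by (simp add: V_def power_mult_distrib power_mult power_divide)
  qed
  have "x n = H $ (n - 1)"
    using n by (simp add: G_def flip: \<open>G = H\<close>)
  also have "\<dots> = (\<Sum>j = 0..n - 1. ((1 / real k) gchoose j) * x 1 powi (1 - int k * int j) *
      (W ^ j $ (n - 1)))"
    by (simp add: H_def fps_compose_nth sum_distrib_left term_eq del: One_nat_def)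
  finally show ?thesis
    by (simp add: bell_ordinary_eq_fps_nth W_def)
qed

text \<open>
  For $k = 1$ the terms $j \ge 2$ vanish because $\binom{1}{j} = 0$; this is why $x_1 = 0$ is
  allowed there.
\<close>

lemma bell_ordinary_inverse:
  fixes x :: "nat \<Rightarrow> real"
  assumes n: "n \<ge> 1" and k: "k \<ge> 1" and x1: "x 1 \<noteq> 0 \<or> k = 1 \<or> n = 1"
  shows "x n = (\<Sum>j = 0..n - 1. ((1 / real k) gchoose j) * x 1 powi (1 - int k * int j) *
    bell_ordinary (n - 1) j (\<lambda>m. bell_ordinary (m + k) k x))"
proof -
  consider "x 1 \<noteq> 0" | "n = 1" | "k = 1" "n \<ge> 2"
    using x1 n by linarith
  then show ?thesis
  proof cases
    case 1
    then show ?thesis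
      using n k by (rule bell_ordinary_inverse_nonzero[rotated 2])
  next
    case 2
    then show ?thesis
      by (simp add: bell_ordinary_eq_fps_nth)
  next
    case 3
    let ?t = "\<lambda>j. (1 gchoose j) * x 1 powi (1 - int j) *
      bell_ordinary (n - 1) j (\<lambda>m. bell_ordinary (m + 1) 1 x)"
    have "(1 :: real) gchoose j = 0" if "j \<ge> 2" for j
    proof -
      have "(1 :: real) gchoose j = real (1 choose j)"
        by (simp only: binomial_gbinomial of_nat_1)
      with that show ?thesis
        by (simp add: binomial_eq_0)
    qed
    then have "(\<Sum>j = 0..n - 1. ?t j) = (\<Sum>j\<in>{0, 1}. ?t j)"
      using 3 by (intro sum.mono_neutral_right) auto
    \<comment> \<open>The term j = 0 vanishes because \<open>n - 1\<close> is positive. The term j =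
      1 is \<open>x n\<close>, its factor \<open>x 1 powi 0\<close> being 1 even if
      \<open>x 1\<close> is 0.\<close>
    also have "\<dots> = x n"
      using 3 by (simp add: bell_ordinary_eq_fps_nth)
    finally show ?thesis
      using 3 by simp
  qed
qed

section \<open>Transfer to the exponential type\<close>

lemma bell_partial_eq_bell_ordinary:
  "bell_partial n k x = fact n / fact k * bell_ordinary n k (\<lambda>m. x m / fact m)"
  by (simp add: bell_ordinary_def)

theorem theorem2:
  fixes x :: "nat \<Rightarrow> real" and n k :: nat
  assumes "n \<ge> 1" and "k \<ge> 1"
    and "x 1 \<noteq> 0 \<or> k = 1 \<or> n = 1"
  shows
    "(\<forall>y :: nat \<Rightarrow> real. (\<forall>m\<ge>1. y m = bell_ordinary m k x) \<longrightarrow>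
        x n = (\<Sum>j = 0..n - 1. ((1 / real k) gchoose j) * x 1 powi (1 - int k * int j) *
                 bell_ordinary (n - 1) j (\<lambda>m. y (m + k))))
     \<and>
     (\<forall>y :: nat \<Rightarrow> real. (\<forall>m\<ge>1. y m = bell_partial m k x) \<longrightarrow>
        x n = (\<Sum>j = 0..n - 1. falling_factorial (1 / real k) j * x 1 powi (1 - int k * int j) *
                 real n * bell_partial (n - 1) j (\<lambda>m. y (m + k) / real ((m + k) choose k))))"
proof (intro conjI allI impI)
  fix y :: "nat \<Rightarrow> real"
  assume y: "\<forall>m\<ge>1. y m = bell_ordinary m k x"
  \<comment> \<open>Equality holds at m = 0 as well, since \<open>m + k\<close> is at least
    1.\<close>
  have "(\<lambda>m. y (m + k)) = (\<lambda>m. bell_ordinary (m + k) k x)"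
    using y assms(2) by auto
  then show "x n = (\<Sum>j = 0..n - 1. ((1 / real k) gchoose j) * x 1 powi (1 - int k * int j) *
      bell_ordinary (n - 1) j (\<lambda>m. y (m + k)))"
    using bell_ordinary_inverse[of n k x] assms by simp
next
  fix y :: "nat \<Rightarrow> real"
  assume y: "\<forall>m\<ge>1. y m = bell_partial m k x"
  define x' where "x' = (\<lambda>m. x m / fact m)"
  define w where "w = (\<lambda>m. y (m + k) / real ((m + k) choose k))"
  \<comment> \<open>Dividing \<open>y (m + k)\<close>, which is (m+k)!/k! times the ordinary
    polynomial, by C(m+k,k) leaves exactly the factor m!.\<close>
  have w: "w m / fact m = bell_ordinary (m + k) k x'" for m
  proof -
    have "real ((m + k) choose k) = fact (m + k) / (fact k * fact m)"
      by (subst binomial_fact) auto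
    then show ?thesis
      using y assms(2) by (simp add: w_def x'_def bell_partial_eq_bell_ordinary)
  qed
  have fact_n: "fact n = real n * fact (n - 1)"
    using assms(1) by (simp add: fact_reduce)
  have "x n = fact n * x' n"
    by (simp add: x'_def)
  also have "x' n = (\<Sum>j = 0..n - 1. ((1 / real k) gchoose j) * x' 1 powi (1 - int k * int j) *
      bell_ordinary (n - 1) j (\<lambda>m. bell_ordinary (m + k) k x'))"
    using assms by (intro bell_ordinary_inverse) (auto simp: x'_def)
  \<comment> \<open>Write n! = n (n-1)!. The j! in the denominator of the binomial coefficient joins
    (n-1)! to form the factor that converts the ordinary polynomial into
    \<open>bell_partial (n - 1) j w\<close>.\<close>
  also have "fact n * \<dots> = (\<Sum>j = 0..n - 1. falling_factorial (1 / real k) j *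
      x 1 powi (1 - int k * int j) * real n * bell_partial (n - 1) j w)"
    by (simp add: sum_distrib_left gbinomial_eq_falling_factorial fact_n
        bell_partial_eq_bell_ordinary w x'_def mult_ac)
  finally show "x n = (\<Sum>j = 0..n - 1. falling_factorial (1 / real k) j *
      x 1 powi (1 - int k * int j) * real n *
      bell_partial (n - 1) j (\<lambda>m. y (m + k) / real ((m + k) choose k)))"
    by (simp add: w_def)
qed

end
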